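(* Let $\mathbb{H}$ be a real or complex Hilbert space and let $T, A \in K(\mathbb{H})$ be such that $T \notin \mathrm{span}\{A\}$. Then $$\mathrm{dist}(T, \mathrm{span}\{A\}) = \max\{|\langle Tx, y\rangle| : x, y \in S_{\mathbb{H}},\ y \perp Ax\}.$$
   Context: $K(\mathbb{H})$ is the Banach space of compact linear operators on $\mathbb{H}$ with the operator norm; $S_{\mathbb{H}}$ is the unit sphere of $\mathbb{H}$; $\langle\cdot,\cdot\rangle$ is the inner product and $\perp$ the usual orthogonality in $\mathbb{H}$. For an element $x$ and a subspace $\mathbb{V}$ of a Banach space, $\mathrm{dist}(x,\mathbb{V}) = \inf\{\|x-z\| : z\in\mathbb{V}\}$. *)

theory Defs
  imports "HOL-Analysis.Analysis"
begin

text \<open>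
  HOL-Analysis provides real inner product spaces only.  The complex spaces below keep their
  underlying real structure (norm, metric, real scalar multiplication); the two scalar
  multiplications agree on real scalars.
\<close>

class complex_vector = real_vector +
  fixes scaleC :: "complex \<Rightarrow> 'a \<Rightarrow> 'a" (infixr "*\<^sub>C" 75)
  assumes scaleC_add_right: "a *\<^sub>C (x + y) = a *\<^sub>C x + a *\<^sub>C y"
    and scaleC_add_left: "(a + b) *\<^sub>C x = a *\<^sub>C x + b *\<^sub>C x"
    and scaleC_scaleC: "a *\<^sub>C (b *\<^sub>C x) = (a * b) *\<^sub>C x"
    and scaleC_of_real: "complex_of_real r *\<^sub>C x = r *\<^sub>R x"

lemma vector_space_scaleC:
  "vector_space (scaleC :: complex \<Rightarrow> 'a \<Rightarrow> 'a::complex_vector)"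
proof
  show "1 *\<^sub>C x = x" for x :: 'a
    using scaleC_of_real[of 1 x] by simp
qed (simp_all add: scaleC_add_right scaleC_add_left scaleC_scaleC)

abbreviation cspan :: "'a::complex_vector set \<Rightarrow> 'a set"
  where "cspan \<equiv> module.span scaleC"

abbreviation clinear :: "('a::complex_vector \<Rightarrow> 'b::complex_vector) \<Rightarrow> bool"
  where "clinear \<equiv> Vector_Spaces.linear scaleC scaleC"

class complex_normed_vector = complex_vector + real_normed_vector +
  assumes norm_scaleC: "norm (a *\<^sub>C x) = cmod a * norm x"

text \<open>The inner product is linear in its first argument.\<close>

class complex_inner = complex_normed_vector +
  fixes cinner :: "'a \<Rightarrow> 'a \<Rightarrow> complex"
  assumes cinner_add_left: "cinner (x + y) z = cinner x z + cinner y z"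
    and cinner_scaleC_left: "cinner (a *\<^sub>C x) y = a * cinner x y"
    and cinner_commute: "cinner x y = cnj (cinner y x)"
    and norm_eq_sqrt_cinner: "norm x = sqrt (Re (cinner x x))"

text \<open>
  Positive definiteness of \<^const>\<open>cinner\<close> is not an axiom of its own: it follows from the last
  axiom together with the norm axioms.
\<close>

lemma cinner_self: "cinner x x = complex_of_real ((norm (x::'a::complex_inner))\<^sup>2)"
proof -
  have im: "Im (cinner x x) = 0"
    using arg_cong[OF cinner_commute[of x x], of Im] by simp
  have "0 \<le> Re (cinner x x)"
    using norm_ge_zero[of x] norm_eq_sqrt_cinner[of x] by (metis real_sqrt_ge_0_iff)
  then have "Re (cinner x x) = (norm x)\<^sup>2"
    by (simp add: norm_eq_sqrt_cinner)
  with im show ?thesis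
    by (simp add: complex_eq_iff)
qed

lemma cinner_self_eq_0_iff: "cinner x x = 0 \<longleftrightarrow> (x::'a::complex_inner) = 0"
  by (simp add: cinner_self)

instantiation complex :: complex_inner
begin

definition scaleC_complex :: "complex \<Rightarrow> complex \<Rightarrow> complex"
  where "scaleC_complex a x = a * x"

definition cinner_complex :: "complex \<Rightarrow> complex \<Rightarrow> complex"
  where "cinner_complex x y = x * cnj y"

instance
proof
  fix a b x y z :: complex and r :: real
  show "a *\<^sub>C (x + y) = a *\<^sub>C x + a *\<^sub>C y"
    by (simp add: scaleC_complex_def ring_distribs)
  show "(a + b) *\<^sub>C x = a *\<^sub>C x + b *\<^sub>C x"
    by (simp add: scaleC_complex_def ring_distribs)
  show "a *\<^sub>C (b *\<^sub>C x) = (a * b) *\<^sub>C x"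
    by (simp add: scaleC_complex_def)
  show "complex_of_real r *\<^sub>C x = r *\<^sub>R x"
    by (simp add: scaleC_complex_def scaleR_conv_of_real)
  show "norm (a *\<^sub>C x) = cmod a * norm x"
    by (simp add: scaleC_complex_def norm_mult)
  show "cinner (x + y) z = cinner x z + cinner y z"
    by (simp add: cinner_complex_def ring_distribs)
  show "cinner (a *\<^sub>C x) y = a * cinner x y"
    by (simp add: cinner_complex_def scaleC_complex_def)
  show "cinner x y = cnj (cinner y x)"
    by (simp add: cinner_complex_def)
  show "norm x = sqrt (Re (cinner x x))"
    by (simp add: cinner_complex_def complex_norm_square[symmetric] cmod_def power2_eq_square)
qed

end

text \<open>
  Bounded operators are elements of the library type of bounded (real-)linear maps, which carries
  the operator norm.  A bounded operator between complex spaces is such a map that is moreover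
  \<^const>\<open>Vector_Spaces.linear\<close> over the complex numbers; its operator norm does not depend on the
  scalar field.
\<close>

instantiation blinfun :: (real_normed_vector, complex_normed_vector) complex_vector
begin

lift_definition scaleC_blinfun :: "complex \<Rightarrow> ('a \<Rightarrow>\<^sub>L 'b) \<Rightarrow> ('a \<Rightarrow>\<^sub>L 'b)"
  is "\<lambda>c f x. c *\<^sub>C f x"
proof -
  fix c :: complex and f :: "'a \<Rightarrow> 'b"
  assume f: "bounded_linear f"
  have "bounded_linear (\<lambda>y::'b. c *\<^sub>C y)"
  proof (rule bounded_linear_intro[where K = "cmod c"])
    show "c *\<^sub>C (r *\<^sub>R y) = r *\<^sub>R (c *\<^sub>C y)" for r and y :: 'b
      by (metis scaleC_of_real scaleC_scaleC mult.commute)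
  qed (simp_all add: scaleC_add_right norm_scaleC)
  from bounded_linear_compose[OF this f] show "bounded_linear (\<lambda>x. c *\<^sub>C f x)" .
qed

instance
proof
  fix a b :: complex and x y :: "'a \<Rightarrow>\<^sub>L 'b" and r :: real
  show "a *\<^sub>C (x + y) = a *\<^sub>C x + a *\<^sub>C y"
    by transfer (rule ext, rule scaleC_add_right)
  show "(a + b) *\<^sub>C x = a *\<^sub>C x + b *\<^sub>C x"
    by transfer (rule ext, rule scaleC_add_left)
  show "a *\<^sub>C (b *\<^sub>C x) = (a * b) *\<^sub>C x"
    by transfer (rule ext, rule scaleC_scaleC)
  show "complex_of_real r *\<^sub>C x = r *\<^sub>R x"
    by transfer (rule ext, rule scaleC_of_real)
qed

end

definition compact_operator ::
    "('a::real_normed_vector \<Rightarrow>\<^sub>L 'b::real_normed_vector) \<Rightarrow> bool"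
  where "compact_operator T \<longleftrightarrow> compact (closure (blinfun_apply T ` cball 0 1))"

definition is_maximum :: "real \<Rightarrow> real set \<Rightarrow> bool"
  where "is_maximum m S \<longleftrightarrow> m \<in> S \<and> (\<forall>s\<in>S. s \<le> m)"

end

theory Submission
  imports Defs
begin

text \<open>
  A line in a normed space contains a nearest point to \<open>T\<close>; let \<open>c0 A\<close> be such a multiple of \<open>A\<close>
  and \<open>S = T - c0 A\<close>.  Then \<open>S\<close> is compact and nonzero, its norm is the distance, and \<open>norm S \<le> norm (S + c A)\<close>
  for all scalars \<open>c\<close>.  The inequality \<open>\<bar>\<langle>T x, y\<rangle>\<bar> = \<bar>\<langle>S x, y\<rangle>\<bar> \<le> norm S\<close> for admissible \<open>x, y\<close> is
  Cauchy--Schwarz.  The value \<open>norm S\<close> is attained if there is a unit vector \<open>x\<close> with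
  \<open>norm (S x) = norm S\<close> and \<open>S x\<close> orthogonal to \<open>A x\<close>: take \<open>y = S x / norm S\<close>.  That such a vector
  exists is the Bhatia--Semrl theorem (\<open>bhatia_semrl_real\<close>, \<open>bhatia_semrl_complex\<close>).

  Its proof avoids adjoints.  Let \<open>E\<close> be the set of vectors at which \<open>S\<close> attains its norm.  By the
  parallelogram law \<open>E\<close> is a subspace (\<open>norm_attaining_add\<close>), and unit vectors \<open>x n\<close> for which
  \<open>norm (S (x n))\<close> tends to \<open>norm S\<close> accumulate at a unit vector of \<open>E\<close>
  (\<open>maximizing_sequence_convergent\<close>); in particular the unit sphere of \<open>E\<close> is compact.  Taking
  almost maximizing unit vectors for \<open>S + t A\<close> and letting \<open>t\<close> decrease to 0 shows that
  \<open>Re \<langle>S x, A x\<rangle> \<ge> 0\<close> for some unit vector \<open>x\<close> of \<open>E\<close> (\<open>norm_attaining_direction\<close>), and the same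
  holds for every scalar multiple of \<open>A\<close>.  Over the reals, apply this to \<open>A\<close> and \<open>- A\<close> and use the
  intermediate value theorem.  Over the complex numbers, choose \<open>x\<close> on the unit sphere of \<open>E\<close> to
  minimize \<open>\<bar>\<langle>A x, S x\<rangle>\<bar>\<close>; were the minimum not 0, there would be a \<open>y\<close> in \<open>E\<close> whose value lies in
  the closed half-plane opposite to that of \<open>x\<close>, and a small step from \<open>x\<close> along a suitable phase of \<open>y\<close>
  would decrease the modulus.  This replaces the convexity of the numerical range.
\<close>

section \<open>Compact operators\<close>

lemma compact_operatorI:
  fixes T :: "'a::real_normed_vector \<Rightarrow>\<^sub>L 'b::real_normed_vector"
  assumes "compact K" and "blinfun_apply T ` cball 0 1 \<subseteq> K"
  shows "compact_operator T"
proof -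
  have "closure (blinfun_apply T ` cball 0 1) \<subseteq> K"
    using assms by (intro closure_minimal compact_imp_closed)
  then have "closure (blinfun_apply T ` cball 0 1) = K \<inter> closure (blinfun_apply T ` cball 0 1)"
    by blast
  then show ?thesis
    unfolding compact_operator_def by (metis assms(1) closed_closure compact_Int_closed)
qed

lemma compact_operator_diff:
  fixes S T :: "'a::real_normed_vector \<Rightarrow>\<^sub>L 'b::real_normed_vector"
  assumes "compact_operator S" "compact_operator T"
  shows "compact_operator (S - T)"
proof (rule compact_operatorI)
  let ?K = "\<lambda>S. closure (blinfun_apply S ` cball 0 1)"
  show "compact {u - v | u v. u \<in> ?K S \<and> v \<in> ?K T}"
    using assms by (intro compact_differences) (simp_all add: compact_operator_def)
  show "blinfun_apply (S - T) ` cball 0 1 \<subseteq> {u - v | u v. u \<in> ?K S \<and> v \<in> ?K T}"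
    using closure_subset[of "blinfun_apply S ` cball 0 1"] closure_subset[of "blinfun_apply T ` cball 0 1"]
    by (auto simp only: blinfun.diff_left) blast
qed

lemma compact_operator_comp_continuous:
  fixes S :: "'a::real_normed_vector \<Rightarrow>\<^sub>L 'b::real_normed_vector"
    and T :: "'a \<Rightarrow>\<^sub>L 'c::real_normed_vector"
  assumes "compact_operator S" "continuous_on UNIV h" "\<And>x. T x = h (S x)"
  shows "compact_operator T"
proof (rule compact_operatorI)
  let ?K = "closure (blinfun_apply S ` cball 0 1)"
  show "compact (h ` ?K)"
    using assms(1) continuous_on_subset[OF assms(2)]
    by (intro compact_continuous_image) (auto simp: compact_operator_def)
  show "blinfun_apply T ` cball 0 1 \<subseteq> h ` ?K"
    using closure_subset by (fastforce simp: assms(3))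
qed

lemma compact_operator_convergent_subseq:
  fixes S :: "'a::real_normed_vector \<Rightarrow>\<^sub>L 'b::real_normed_vector"
  assumes "compact_operator S" and "\<And>n. norm (x n) \<le> 1"
  obtains z and r :: "nat \<Rightarrow> nat" where "strict_mono r" "(\<lambda>n. S (x (r n))) \<longlonglongrightarrow> z"
proof -
  have "\<forall>n. S (x n) \<in> closure (blinfun_apply S ` cball 0 1)"
    using assms(2) closure_subset by (fastforce simp: image_iff)
  then show ?thesis
    using assms(1) that unfolding compact_operator_def compact_def comp_def by meson
qed

section \<open>Best approximation from a line\<close>

lemma ex_nearest_in_range:
  fixes g :: "'c::euclidean_space \<Rightarrow> 'v::real_normed_vector"
  assumes cont: "continuous_on UNIV g" and nrm: "\<And>c. norm (g c) = norm c * k"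
  shows "\<exists>c0. \<forall>c. norm (T - g c0) \<le> norm (T - g c)"
proof (cases "k = 0")
  case True
  then show ?thesis using nrm by simp
next
  case False
  obtain b :: 'c where "norm b = 1" using vector_choose_size[of 1] by auto
  then have "k > 0" using nrm[of b] False norm_ge_zero[of "g b"] by simp
  \<comment> \<open>Outside the ball of radius \<open>?R\<close> every point is at least as far from \<open>T\<close> as \<open>g 0 = 0\<close> is.\<close>
  let ?R = "2 * norm T / k"
  have "continuous_on (cball 0 ?R) (\<lambda>c. norm (T - g c))"
    by (intro continuous_intros continuous_on_subset[OF cont]) auto
  moreover have "0 \<le> ?R" using \<open>k > 0\<close> by simp
  then have "cball (0::'c) ?R \<noteq> {}" by simp
  ultimately obtain c0 where c0: "\<And>c. c \<in> cball 0 ?R \<Longrightarrow> norm (T - g c0) \<le> norm (T - g c)"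
    using continuous_attains_inf[OF compact_cball] by metis
  have "norm (T - g c0) \<le> norm (T - g c)" for c
  proof (cases "c \<in> cball 0 ?R")
    case False
    then have "2 * norm T < norm c * k" using \<open>k > 0\<close> by (simp add: field_simps)
    then have "norm T \<le> norm (T - g c)"
      using nrm[of c] norm_triangle_ineq2[of "g c" T] by (simp add: norm_minus_commute)
    moreover have "norm (T - g c0) \<le> norm T" using c0[of 0] nrm[of 0] \<open>k > 0\<close> by simp
    ultimately show ?thesis by linarith
  qed (rule c0)
  then show ?thesis by blast
qed

lemma infdist_eq_norm_nearest:
  fixes T :: "'v::real_normed_vector"
  assumes "s \<in> X" and "\<And>u. u \<in> X \<Longrightarrow> norm (T - s) \<le> norm (T - u)"
  shows "infdist T X = norm (T - s)"
proof (rule antisym)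
  show "infdist T X \<le> norm (T - s)" using infdist_le[OF assms(1)] by (simp add: dist_norm)
  have "X \<noteq> {}" using assms(1) by blast
  then show "norm (T - s) \<le> infdist T X"
    unfolding infdist_def using assms(2) by (auto simp: dist_norm intro!: cINF_greatest)
qed

section \<open>Operators on a complete space whose norm comes from a real form\<close>

text \<open>
  A complete space whose norm comes from a symmetric real bilinear form \<open>B\<close>.  It applies to a real
  Hilbert space with its inner product, and to a complex Hilbert space with the real part of its
  inner product, whose type need not belong to the class \<^class>\<open>real_inner\<close>.
\<close>

locale real_form =
  fixes B :: "'a::{real_normed_vector, complete_space} \<Rightarrow> 'a \<Rightarrow> real"
  assumes form_add_left: "B (x + y) z = B x z + B y z"
    and form_scaleR_left: "B (r *\<^sub>R x) y = r * B x y"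
    and form_commute: "B x y = B y x"
    and form_self: "B x x = (norm x)\<^sup>2"
begin

lemma form_add_right: "B x (y + z) = B x y + B x z"
  by (metis form_add_left form_commute)

lemma form_scaleR_right: "B x (r *\<^sub>R y) = r * B x y"
  by (metis form_scaleR_left form_commute)

lemma norm_add_scaleR_sq: "(norm (x + t *\<^sub>R y))\<^sup>2 = (norm x)\<^sup>2 + 2 * t * B x y + t\<^sup>2 * (norm y)\<^sup>2"
  unfolding form_self[symmetric]
  by (simp add: form_add_left form_add_right form_scaleR_left form_scaleR_right
      form_commute[of y x] power2_eq_square algebra_simps)

lemma norm_add_sq: "(norm (x + y))\<^sup>2 = (norm x)\<^sup>2 + 2 * B x y + (norm y)\<^sup>2"
  using norm_add_scaleR_sq[of x 1 y] by simp

lemma norm_diff_sq: "(norm (x - y))\<^sup>2 = (norm x)\<^sup>2 - 2 * B x y + (norm y)\<^sup>2"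
  using norm_add_scaleR_sq[of x "-1" y] by simp

lemma polarization: "B x y = ((norm (x + y))\<^sup>2 - (norm (x - y))\<^sup>2) / 4"
  by (simp add: norm_add_sq norm_diff_sq)

lemma parallelogram:
  fixes x y :: 'a
  shows "(norm (x + y))\<^sup>2 + (norm (x - y))\<^sup>2 = 2 * (norm x)\<^sup>2 + 2 * (norm y)\<^sup>2"
  by (simp add: norm_add_sq norm_diff_sq)

lemma form_le_norm_mult: "B x y \<le> norm x * norm y"
proof -
  have "(norm (x + y))\<^sup>2 \<le> (norm x + norm y)\<^sup>2"
    by (intro power_mono norm_triangle_ineq) simp
  moreover have "(norm x - norm y)\<^sup>2 \<le> (norm (x - y))\<^sup>2"
    using norm_triangle_ineq3[of x y] by (simp add: abs_le_square_iff[symmetric])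
  ultimately show ?thesis
    unfolding polarization by (simp add: power2_sum power2_diff)
qed

text \<open>
  By the parallelogram law the vectors at which an operator attains its norm form a subspace.
\<close>

lemma norm_attaining_add:
  fixes S :: "'a \<Rightarrow>\<^sub>L 'a"
  assumes "norm (S x) = norm S * norm x" "norm (S y) = norm S * norm y"
  shows "norm (blinfun_apply S (x + y)) = norm S * norm (x + y)"
proof -
  have le: "(norm (S z))\<^sup>2 \<le> (norm S * norm z)\<^sup>2" for z
    by (intro power_mono norm_blinfun) simp
  have "(norm (S (x + y)))\<^sup>2 + (norm (S (x - y)))\<^sup>2 = 2 * (norm (S x))\<^sup>2 + 2 * (norm (S y))\<^sup>2"
    by (simp only: blinfun.add_right blinfun.diff_right parallelogram)
  also have "\<dots> = (norm S)\<^sup>2 * (2 * (norm x)\<^sup>2 + 2 * (norm y)\<^sup>2)"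
    unfolding assms by (simp add: power_mult_distrib algebra_simps)
  also have "\<dots> = (norm S * norm (x + y))\<^sup>2 + (norm S * norm (x - y))\<^sup>2"
    unfolding parallelogram[symmetric] by (simp only: power_mult_distrib distrib_left)
  finally have "(norm (S (x + y)))\<^sup>2 + (norm (S (x - y)))\<^sup>2
      = (norm S * norm (x + y))\<^sup>2 + (norm S * norm (x - y))\<^sup>2" .
  then have "(norm (S (x + y)))\<^sup>2 = (norm S * norm (x + y))\<^sup>2"
    using le[of "x + y"] le[of "x - y"] by linarith
  then show ?thesis by simp
qed

text \<open>
  Along a maximizing sequence \<open>x n\<close> of a nonzero compact operator the images converge for a
  subsequence, so that the norms of \<open>S (x m + x n)\<close>, and with them those of \<open>x m + x n\<close>, approach
  their largest possible values; the parallelogram law then makes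
  the subsequence of \<open>x n\<close> a Cauchy sequence.
\<close>

lemma maximizing_sequence_convergent:
  fixes S :: "'a \<Rightarrow>\<^sub>L 'a"
  assumes S: "compact_operator S" "S \<noteq> 0" and x: "\<And>n. norm (x n) = 1"
    and lim: "(\<lambda>n. norm (S (x n))) \<longlonglongrightarrow> norm S"
  obtains l and r :: "nat \<Rightarrow> nat" where "strict_mono r" "(\<lambda>n. x (r n)) \<longlonglongrightarrow> l"
    "norm l = 1" "norm (S l) = norm S"
proof -
  obtain z and r :: "nat \<Rightarrow> nat" where r: "strict_mono r" and z: "(\<lambda>n. S (x (r n))) \<longlonglongrightarrow> z"
    using compact_operator_convergent_subseq[of S x] S(1) x by (metis order_refl)
  define M where "M = norm S"
  have M: "M > 0" using S(2) by (simp add: M_def)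
  have nz: "norm z = M"
    unfolding M_def
    by (rule LIMSEQ_unique[OF tendsto_norm[OF z]]) (use LIMSEQ_subseq_LIMSEQ[OF lim r] in \<open>simp add: comp_def\<close>)
  have "Cauchy (\<lambda>n. x (r n))"
  proof (rule metric_CauchyI)
    fix e :: real assume e: "e > 0"
    have "((\<lambda>a. 4 - ((2 * M - 2 * a) / M)\<^sup>2) \<longlongrightarrow> 4 - ((2 * M - 2 * 0) / M)\<^sup>2) (at_right 0)"
      by (intro tendsto_intros) (use M in auto)
    then have "((\<lambda>a. 4 - ((2 * M - 2 * a) / M)\<^sup>2) \<longlongrightarrow> 0) (at_right 0)" using M by simp
    then have "eventually (\<lambda>a. 4 - ((2 * M - 2 * a) / M)\<^sup>2 < e\<^sup>2) (at_right 0)"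
      using e by (intro order_tendstoD) auto
    moreover have "eventually (\<lambda>a. a < M) (at_right 0)"
      using M by (intro order_tendstoD(2)[OF tendsto_ident_at])
    moreover have "eventually (\<lambda>a::real. 0 < a) (at_right 0)"
      by (rule eventually_at_right_less)
    ultimately have "eventually (\<lambda>a. 4 - ((2 * M - 2 * a) / M)\<^sup>2 < e\<^sup>2 \<and> a < M \<and> 0 < a) (at_right 0)"
      by eventually_elim simp
    then obtain a where a: "4 - ((2 * M - 2 * a) / M)\<^sup>2 < e\<^sup>2" "a < M" "0 < a"
      using eventually_happens'[OF trivial_limit_at_right_real] by blast
    obtain N where N: "\<And>n. n \<ge> N \<Longrightarrow> norm (S (x (r n)) - z) < a"
      using LIMSEQ_D[OF z a(3)] by blast
    have "dist (x (r m)) (x (r n)) < e" if "m \<ge> N" "n \<ge> N" for m n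
    proof -
      let ?u = "x (r m)" and ?v = "x (r n)"
      have "2 * norm z = norm (2 *\<^sub>R z)" by simp
      also have "2 *\<^sub>R z = S (?u + ?v) - ((S ?u - z) + (S ?v - z))"
        by (simp add: blinfun.add_right scaleR_2)
      also have "norm \<dots> \<le> norm (S (?u + ?v)) + (norm (S ?u - z) + norm (S ?v - z))"
        by (meson norm_triangle_ineq4 norm_triangle_ineq add_left_mono order_trans)
      finally have "2 * M - 2 * a \<le> norm (S (?u + ?v))"
        using N[OF that(1)] N[OF that(2)] nz by linarith
      also have "\<dots> \<le> M * norm (?u + ?v)" unfolding M_def by (rule norm_blinfun)
      finally have "(2 * M - 2 * a) / M \<le> norm (?u + ?v)" using M by (simp add: field_simps)
      then have "((2 * M - 2 * a) / M)\<^sup>2 \<le> (norm (?u + ?v))\<^sup>2"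
        using M a by (intro power_mono) auto
      then have "(norm (?u - ?v))\<^sup>2 < e\<^sup>2"
        using parallelogram[of ?u ?v] a(1) by (simp add: x)
      then show ?thesis using e by (simp add: dist_norm power_less_imp_less_base)
    qed
    then show "\<exists>N. \<forall>m\<ge>N. \<forall>n\<ge>N. dist (x (r m)) (x (r n)) < e" by blast
  qed
  then obtain l where l: "(\<lambda>n. x (r n)) \<longlonglongrightarrow> l"
    by (meson Cauchy_convergent convergent_def)
  have "norm l = 1"
    using LIMSEQ_unique[OF tendsto_norm[OF l]] x by simp
  moreover have "S l = z"
    using LIMSEQ_unique[OF blinfun.tendsto[OF tendsto_const l] z] .
  ultimately show ?thesis using that r l nz M_def by metis
qed

text \<open>
  If moving from \<open>S\<close> in the direction of \<open>A\<close> does not decrease the norm, then the derivative of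
  \<open>(norm ((S + t *\<^sub>R A) x))\<^sup>2\<close> at \<open>t = 0\<close> is nonnegative for some unit vector \<open>x\<close> where \<open>S\<close> attains
  its norm.
\<close>

lemma norm_attaining_direction:
  fixes S A :: "'a \<Rightarrow>\<^sub>L 'a"
  assumes S: "compact_operator S" "S \<noteq> 0" and min: "\<And>t. t > 0 \<Longrightarrow> norm S \<le> norm (S + t *\<^sub>R A)"
  obtains x where "norm x = 1" "norm (S x) = norm S" "B (S x) (A x) \<ge> 0"
proof -
  define M where "M = norm S"
  have M: "M > 0" using S(2) by (simp add: M_def)
  define e :: "nat \<Rightarrow> real" where "e = (\<lambda>n. 1 / real (Suc n))"
  have e: "0 < e n" "e n \<le> 1" for n by (auto simp: e_def)
  have elim: "e \<longlonglongrightarrow> 0" unfolding e_def by (rule LIMSEQ_Suc[OF lim_1_over_n])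
  \<comment> \<open>The defect \<open>(e n)\<^sup>2\<close> is of smaller order than the step \<open>e n\<close>, so it is lost in the limit.\<close>
  have "\<exists>x. norm x = 1 \<and> M * (1 - (e n)\<^sup>2) < norm ((S + e n *\<^sub>R A) x)" for n
  proof -
    have e2: "0 < (e n)\<^sup>2" "(e n)\<^sup>2 \<le> 1" using e[of n] by (auto simp: power_le_one)
    have "\<not> (\<forall>x. norm ((S + e n *\<^sub>R A) x) \<le> M * (1 - (e n)\<^sup>2) * norm x)"
    proof
      assume "\<forall>x. norm ((S + e n *\<^sub>R A) x) \<le> M * (1 - (e n)\<^sup>2) * norm x"
      then have "norm (S + e n *\<^sub>R A) \<le> M * (1 - (e n)\<^sup>2)"
        using M e2 by (intro norm_blinfun_bound) auto
      moreover have "M * (1 - (e n)\<^sup>2) < M * 1"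
        using M e2 by (intro mult_strict_left_mono) auto
      ultimately show False using min[OF e(1)[of n]] by (simp add: M_def)
    qed
    then obtain y where y: "M * (1 - (e n)\<^sup>2) * norm y < norm ((S + e n *\<^sub>R A) y)"
      by (meson not_le)
    then have "y \<noteq> 0" by auto
    then have "norm ((1 / norm y) *\<^sub>R y) = 1"
        "M * (1 - (e n)\<^sup>2) < norm ((S + e n *\<^sub>R A) ((1 / norm y) *\<^sub>R y))"
      using y by (simp_all add: blinfun.scaleR_right field_simps)
    then show ?thesis by blast
  qed
  then obtain x where x: "\<And>n. norm (x n) = 1"
    and big: "\<And>n. M * (1 - (e n)\<^sup>2) < norm ((S + e n *\<^sub>R A) (x n))"
    by metis
  have le: "norm (S (x n)) \<le> M" "norm (A (x n)) \<le> norm A" for n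
    using norm_blinfun[of S "x n"] norm_blinfun[of A "x n"] by (simp_all add: x M_def)
  have lower: "M * (1 - (e n)\<^sup>2) - e n * norm A \<le> norm (S (x n))" for n
  proof -
    have "norm ((S + e n *\<^sub>R A) (x n)) \<le> norm (S (x n)) + e n * norm (A (x n))"
      using norm_triangle_ineq[of "S (x n)" "e n *\<^sub>R A (x n)"] e(1)[of n]
      by (simp add: blinfun.add_left blinfun.scaleR_left)
    moreover have "e n * norm (A (x n)) \<le> e n * norm A"
      using le(2)[of n] e(1)[of n] by simp
    ultimately show ?thesis using big[of n] by linarith
  qed
  have "(\<lambda>n. norm (S (x n))) \<longlonglongrightarrow> M"
  proof (rule tendsto_sandwich)
    have "(\<lambda>n. M * (1 - (e n)\<^sup>2) - e n * norm A) \<longlonglongrightarrow> M * (1 - 0\<^sup>2) - 0 * norm A"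
      by (intro tendsto_intros elim)
    then show "(\<lambda>n. M * (1 - (e n)\<^sup>2) - e n * norm A) \<longlonglongrightarrow> M" by simp
  qed (use lower le in auto)
  then obtain l and r :: "nat \<Rightarrow> nat" where r: "strict_mono r" and l: "(\<lambda>n. x (r n)) \<longlonglongrightarrow> l"
    "norm l = 1" "norm (S l) = norm S"
    using maximizing_sequence_convergent[OF S, of x] x unfolding M_def by blast
  have form: "- (e n * (2 * M\<^sup>2 + (norm A)\<^sup>2)) \<le> 2 * B (S (x n)) (A (x n))" for n
  proof -
    have "M\<^sup>2 * (1 - 2 * (e n)\<^sup>2) \<le> M\<^sup>2 * (1 - (e n)\<^sup>2)\<^sup>2"
      by (intro mult_left_mono) (auto simp: power2_diff)
    also have "\<dots> = (M * (1 - (e n)\<^sup>2))\<^sup>2" by (simp add: power_mult_distrib)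
    also have "\<dots> \<le> (norm ((S + e n *\<^sub>R A) (x n)))\<^sup>2"
      using big[of n] M e[of n] by (intro power_mono) (auto simp: power_le_one)
    also have "\<dots> = (norm (S (x n)))\<^sup>2 + 2 * e n * B (S (x n)) (A (x n)) + (e n)\<^sup>2 * (norm (A (x n)))\<^sup>2"
      by (simp add: blinfun.add_left blinfun.scaleR_left norm_add_scaleR_sq)
    also have "\<dots> \<le> M\<^sup>2 + 2 * e n * B (S (x n)) (A (x n)) + (e n)\<^sup>2 * (norm A)\<^sup>2"
      using le[of n] e(1)[of n] by (intro add_mono mult_left_mono power_mono) auto
    finally have "0 \<le> e n * (2 * B (S (x n)) (A (x n)) + e n * (2 * M\<^sup>2 + (norm A)\<^sup>2))"
      by (simp add: algebra_simps power2_eq_square)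
    then show ?thesis using e(1)[of n] by (simp add: zero_le_mult_iff)
  qed
  have "(\<lambda>n. - (e (r n) * (2 * M\<^sup>2 + (norm A)\<^sup>2))) \<longlonglongrightarrow> - (0 * (2 * M\<^sup>2 + (norm A)\<^sup>2))"
    using LIMSEQ_subseq_LIMSEQ[OF elim r] by (intro tendsto_intros) (simp add: comp_def)
  moreover have "(\<lambda>n. 2 * B (S (x (r n))) (A (x (r n)))) \<longlonglongrightarrow> 2 * B (S l) (A l)"
    unfolding polarization by (intro tendsto_intros blinfun.tendsto l) auto
  ultimately have "- (0 * (2 * M\<^sup>2 + (norm A)\<^sup>2)) \<le> 2 * B (S l) (A l)"
    by (rule LIMSEQ_le) (use form in auto)
  then show ?thesis using that l by simp
qed

text \<open>
  The Bhatia--Semrl theorem for real scalars: the quadratic form \<open>\<lambda>x. B (S x) (A x)\<close> has a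
  nonnegative and a nonpositive value at unit vectors of the subspace where \<open>S\<close> attains its norm,
  hence it vanishes somewhere on the segment between them.
\<close>

lemma bhatia_semrl_real:
  fixes S A :: "'a \<Rightarrow>\<^sub>L 'a"
  assumes S: "compact_operator S" "S \<noteq> 0" and min: "\<And>t. norm S \<le> norm (S + t *\<^sub>R A)"
  obtains x where "norm x = 1" "norm (S x) = norm S" "B (S x) (A x) = 0"
proof -
  obtain x where x: "norm x = 1" "norm (S x) = norm S" "B (S x) (A x) \<ge> 0"
    using norm_attaining_direction[OF S min] by blast
  have "norm S \<le> norm (S + t *\<^sub>R (- A))" for t
    using min[of "-t"] by simp
  then obtain y where y: "norm y = 1" "norm (S y) = norm S" "B (S y) ((- A) y) \<ge> 0"
    using norm_attaining_direction[OF S] by blast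
  have yneg: "B (S y) (A y) \<le> 0"
    using y(3) form_scaleR_right[of "S y" "-1" "A y"] by (simp add: blinfun.minus_left)
  define z where "z t = (1 - t) *\<^sub>R x + t *\<^sub>R y" for t :: real
  have "\<exists>t\<ge>0. t \<le> 1 \<and> B (S (z t)) (A (z t)) = 0"
  proof (rule IVT2')
    show "continuous_on {0..1} (\<lambda>t. B (S (z t)) (A (z t)))"
      unfolding z_def polarization by (intro continuous_intros) auto
  qed (use x yneg in \<open>auto simp: z_def\<close>)
  then obtain t where t: "0 \<le> t" "t \<le> 1" "B (S (z t)) (A (z t)) = 0" by blast
  show ?thesis
  proof (cases "z t = 0")
    case True
    \<comment> \<open>The segment meets 0 only if \<open>y = - x\<close>, and then both end points have the same value.\<close>
    then have eq: "(1 - t) *\<^sub>R x = - (t *\<^sub>R y)" by (simp add: z_def eq_neg_iff_add_eq_0)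
    then have "norm ((1 - t) *\<^sub>R x) = norm (t *\<^sub>R y)" by simp
    then have half: "t = 1/2" using x y t by simp
    have "(1/2) *\<^sub>R y = (1/2) *\<^sub>R ((-1) *\<^sub>R x)" using eq unfolding half by simp
    then have "y = (-1) *\<^sub>R x" by (simp only: scaleR_cancel_left) simp
    then have "B (S y) (A y) = B (S x) (A x)"
      by (simp only: blinfun.scaleR_right form_scaleR_left form_scaleR_right)
    then show ?thesis using that x yneg by simp
  next
    case False
    let ?u = "(1 / norm (z t)) *\<^sub>R z t"
    have "norm (S (z t)) = norm S * norm (z t)"
      unfolding z_def
      by (rule norm_attaining_add) (use x y in \<open>simp_all add: blinfun.scaleR_right\<close>)
    then have "norm ?u = 1" "norm (S ?u) = norm S"
      using False by (simp_all add: blinfun.scaleR_right)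
    moreover have "B (S ?u) (A ?u) = 0"
      using t by (simp add: blinfun.scaleR_right form_scaleR_left form_scaleR_right)
    ultimately show ?thesis using that by blast
  qed
qed

end

interpretation real_inner_form: real_form "inner :: 'a::{real_inner, complete_space} \<Rightarrow> 'a \<Rightarrow> real"
  by unfold_locales (simp_all add: inner_add_left power2_norm_eq_inner, rule inner_commute)

section \<open>Complex inner products and complex-linear operators\<close>

lemma scaleR_eq_scaleC: "r *\<^sub>R (x::'a::complex_vector) = complex_of_real r *\<^sub>C x"
  by (simp add: scaleC_of_real)

interpretation complex_inner_form:
  real_form "\<lambda>x y :: 'a::{complex_inner, complete_space}. Re (cinner x y)"
proof
  fix x y :: 'a
  show "Re (cinner x y) = Re (cinner y x)" by (subst cinner_commute) simp
qed (simp_all add: cinner_add_left cinner_scaleC_left cinner_self scaleR_eq_scaleC)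

lemma cinner_add_right: "cinner x (y + z) = cinner x y + cinner x z"
  by (metis cinner_add_left cinner_commute complex_cnj_add)

lemma cinner_scaleC_right: "cinner x (a *\<^sub>C y) = cnj a * cinner x y"
  by (metis cinner_scaleC_left cinner_commute complex_cnj_mult)

lemma ex_unimodular_mult_real:
  obtains e :: complex where "cmod e = 1" "Im (d * e) = 0" "Re (d * e) = cmod d"
proof (cases "d = 0")
  case True
  then show ?thesis using that[of 1] by simp
next
  case False
  have "d * (cnj d / cmod d) = complex_of_real (cmod d)"
    using False by (simp add: complex_norm_square[symmetric] power2_eq_square)
  then show ?thesis using that[of "cnj d / cmod d"] False by (simp add: norm_divide)
qed

lemma cmod_cinner_le_norm_mult:
  "cmod (cinner x y) \<le> norm (x::'a::{complex_inner, complete_space}) * norm y"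
proof -
  obtain e where e: "cmod e = 1" "Re (cinner x y * e) = cmod (cinner x y)"
    using ex_unimodular_mult_real by metis
  have "cmod (cinner x y) = Re (cinner (e *\<^sub>C x) y)"
    using e by (simp add: cinner_scaleC_left mult.commute)
  also have "\<dots> \<le> norm (e *\<^sub>C x) * norm y" by (rule complex_inner_form.form_le_norm_mult)
  finally show ?thesis using e by (simp add: norm_scaleC)
qed

lemma scaleC_blinfun_apply:
  fixes T :: "'a::real_normed_vector \<Rightarrow>\<^sub>L 'b::complex_normed_vector"
  shows "(c *\<^sub>C T) x = c *\<^sub>C (T x)"
  by transfer simp

lemma norm_scaleC_blinfun:
  fixes T :: "'a::real_normed_vector \<Rightarrow>\<^sub>L 'b::complex_normed_vector"
  shows "norm (c *\<^sub>C T) = cmod c * norm T"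
proof (rule antisym)
  have le: "norm (c *\<^sub>C T) \<le> cmod c * norm T" for c and T :: "'a \<Rightarrow>\<^sub>L 'b"
    by (rule norm_blinfun_bound)
      (auto simp: scaleC_blinfun_apply norm_scaleC mult.assoc intro!: mult_left_mono norm_blinfun)
  show "norm (c *\<^sub>C T) \<le> cmod c * norm T" by (rule le)
  show "cmod c * norm T \<le> norm (c *\<^sub>C T)"
  proof (cases "c = 0")
    case False
    have "norm T = norm ((1 / c) *\<^sub>C (c *\<^sub>C T))"
      using False scaleC_of_real[of 1 T] by (simp add: scaleC_scaleC)
    also have "\<dots> \<le> cmod (1 / c) * norm (c *\<^sub>C T)" by (rule le)
    finally show ?thesis using False by (simp add: norm_divide field_simps)
  qed simp
qed

lemma bounded_linear_scaleC_left:
  "bounded_linear (\<lambda>c. c *\<^sub>C (T :: 'a::real_normed_vector \<Rightarrow>\<^sub>L 'b::complex_normed_vector))"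
  by (rule bounded_linear_intro[where K = "norm T"])
    (simp_all add: scaleC_add_left norm_scaleC_blinfun scaleR_conv_of_real scaleC_scaleC[symmetric] scaleC_of_real)

lemma continuous_on_scaleC_right: "continuous_on X (\<lambda>x::'a::complex_normed_vector. c *\<^sub>C x)"
proof -
  have "bounded_linear (\<lambda>x::'a. c *\<^sub>C x)"
    by (rule bounded_linear_intro[where K = "cmod c"])
      (simp_all add: scaleC_add_right norm_scaleC scaleR_eq_scaleC scaleC_scaleC mult.commute)
  then show ?thesis by (rule linear_continuous_on)
qed

lemma cspan_singleton: "cspan {A} = range (\<lambda>c. c *\<^sub>C A)"
proof -
  interpret V: vector_space "scaleC :: complex \<Rightarrow> 'a \<Rightarrow> 'a" by (rule vector_space_scaleC)
  show ?thesis by (rule V.span_singleton)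
qed

lemma clinear_scaleC: "clinear f \<Longrightarrow> f (c *\<^sub>C x) = c *\<^sub>C f x"
  by (simp add: Vector_Spaces.linear_iff)

section \<open>The Bhatia--Semrl theorem for complex scalars\<close>

text \<open>
  If \<open>W + t * c + t\<^sup>2 * b\<close> with \<open>Re b = r\<close> and \<open>Im b = m\<close> is the value of a quadratic form at
  \<open>x + t *\<^sub>R u\<close>, and \<open>1 + 2 * t * s + t\<^sup>2\<close> the squared norm of that vector, then, for small
  positive \<open>t\<close>, the normalized form is smaller in modulus than \<open>W\<close>: the first-order terms do not
  increase it, as \<open>c \<le> 2 * s * W\<close>, and the second-order ones decrease it, as \<open>r \<le> 0 < W\<close>.
\<close>

lemma ex_decreasing_step:
  fixes W r c s m :: real
  assumes W: "W > 0" and r: "r \<le> 0" and c: "c \<le> 2 * s * W"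
  shows "\<exists>t>0. (W + t * c + t\<^sup>2 * r)\<^sup>2 + (t\<^sup>2 * m)\<^sup>2 < (W * (1 + 2 * t * s + t\<^sup>2))\<^sup>2"
proof -
  define P where "P t = W * (1 + 2 * t * s + t\<^sup>2)" for t
  define Q where "Q t = W + t * c + t\<^sup>2 * r" for t
  have "((\<lambda>t. W * (P t + Q t) - t\<^sup>2 * m\<^sup>2) \<longlongrightarrow>
      W * (W * (1 + 2 * 0 * s + 0\<^sup>2) + (W + 0 * c + 0\<^sup>2 * r)) - 0\<^sup>2 * m\<^sup>2) (at_right 0)"
    unfolding P_def Q_def by (intro tendsto_intros)
  then have "eventually (\<lambda>t. 0 < W * (P t + Q t) - t\<^sup>2 * m\<^sup>2) (at_right 0)"
    by (rule order_tendstoD) (use W in simp)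
  moreover have "eventually (\<lambda>t::real. 0 < t) (at_right 0)" by (rule eventually_at_right_less)
  ultimately have "eventually (\<lambda>t. 0 < W * (P t + Q t) - t\<^sup>2 * m\<^sup>2 \<and> 0 < t) (at_right 0)"
    by eventually_elim simp
  then obtain t where t: "0 < W * (P t + Q t) - t\<^sup>2 * m\<^sup>2" "0 < t"
    using eventually_happens'[OF trivial_limit_at_right_real] by blast
  have "0 < W * (P t + Q t)"
    using t(1) zero_le_power2[of "t * m"] unfolding power_mult_distrib by linarith
  then have pos: "0 < P t + Q t" using W by (simp add: zero_less_mult_iff)
  have "P t - Q t = W * t\<^sup>2 + t * (2 * s * W - c) - t\<^sup>2 * r"
    by (simp add: P_def Q_def algebra_simps)
  moreover have "0 \<le> t * (2 * s * W - c)" using t c by simp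
  moreover have "t\<^sup>2 * r \<le> 0" using r by (simp add: mult_nonneg_nonpos)
  ultimately have diff: "W * t\<^sup>2 \<le> P t - Q t" by linarith
  have "(t\<^sup>2 * m)\<^sup>2 = t\<^sup>2 * (t\<^sup>2 * m\<^sup>2)" by (simp add: power2_eq_square)
  also have "\<dots> < t\<^sup>2 * (W * (P t + Q t))" using t by (intro mult_strict_left_mono) auto
  also have "\<dots> = (W * t\<^sup>2) * (P t + Q t)" by simp
  also have "\<dots> \<le> (P t - Q t) * (P t + Q t)" using diff pos by (intro mult_right_mono) auto
  also have "\<dots> = (P t)\<^sup>2 - (Q t)\<^sup>2" by (simp add: power2_eq_square algebra_simps)
  finally show ?thesis using t(2) unfolding P_def Q_def by (intro exI[of _ t]) simp
qed

text \<open>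
  The modulus of \<open>\<lambda>x. cinner (A x) (S x)\<close> has a minimum over the unit vectors at which \<open>S\<close> attains
  its norm, because that set is sequentially compact.  A nonzero minimum could be made smaller by
  moving towards a vector where the form, divided by its value at the minimizer, has nonpositive
  real part.
\<close>

lemma bhatia_semrl_complex:
  fixes S A :: "'a::{complex_inner, complete_space} \<Rightarrow>\<^sub>L 'a"
  assumes S: "compact_operator S" "S \<noteq> 0" and lin: "clinear S" "clinear A"
    and min: "\<And>c. norm S \<le> norm (S + c *\<^sub>C A)"
  obtains x where "norm x = 1" "norm (S x) = norm S" "cinner (A x) (S x) = 0"
proof -
  define q where "q x = cinner (A x) (S x)" for x
  define X where "X = {x. norm x = 1 \<and> norm (S x) = norm S}"
  have cont: "continuous_on X (\<lambda>x. cmod (q x))"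
  proof -
    \<comment> \<open>Real and imaginary part are polarized into norms, whose continuity is known.\<close>
    have "q x = Complex (Re (cinner (A x) (S x))) (Re (cinner (A x) (\<i> *\<^sub>C S x)))" for x
      by (simp add: q_def complex_eq_iff cinner_scaleC_right)
    then show ?thesis
      unfolding complex_inner_form.polarization Complex_eq
      by (simp only:) (intro continuous_intros
          continuous_on_compose2[OF continuous_on_scaleC_right[of UNIV] _ subset_UNIV]; simp)
  qed
  have "seq_compact X"
  proof (rule seq_compactI)
    fix f :: "nat \<Rightarrow> 'a" assume "\<forall>n. f n \<in> X"
    then have "\<And>n. norm (f n) = 1" "(\<lambda>n. norm (S (f n))) \<longlonglongrightarrow> norm S" by (auto simp: X_def)
    then obtain l and r :: "nat \<Rightarrow> nat" where "strict_mono r" "(\<lambda>n. f (r n)) \<longlonglongrightarrow> l"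
        "norm l = 1" "norm (S l) = norm S"
      using complex_inner_form.maximizing_sequence_convergent[OF S] by metis
    then show "\<exists>l\<in>X. \<exists>r. strict_mono r \<and> (f \<circ> r) \<longlonglongrightarrow> l" by (auto simp: X_def comp_def)
  qed
  then have "compact X" by (simp add: compact_eq_seq_compact_metric)
  moreover have "X \<noteq> {}"
    \<comment> \<open>With the zero direction, that lemma says that a compact operator attains its norm.\<close>
    using complex_inner_form.norm_attaining_direction[OF S, of 0] by (auto simp: X_def)
  ultimately obtain x where x: "x \<in> X" and xmin: "\<And>y. y \<in> X \<Longrightarrow> cmod (q x) \<le> cmod (q y)"
    using continuous_attains_inf[OF _ _ cont] by blast
  show ?thesis
  proof (cases "q x = 0")
    case True
    then show ?thesis using that x by (auto simp: X_def q_def)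
  next
    case False
    \<comment> \<open>The factor \<open>cnj (q x)\<close> makes the value of the form at \<open>x\<close> the positive number \<open>W\<close>.\<close>
    define p where "p u v = cnj (q x) * cinner (A u) (S v)" for u v
    define W where "W = (cmod (q x))\<^sup>2"
    have W: "W > 0" using False by (simp add: W_def)
    have px: "p x x = complex_of_real W"
      unfolding p_def W_def q_def[symmetric] using complex_norm_square[of "q x"] by (simp add: mult.commute)
    have "norm S \<le> norm (S + t *\<^sub>R ((- cnj (q x)) *\<^sub>C A))" for t
      using min[of "t * (- cnj (q x))"] by (simp add: scaleR_eq_scaleC scaleC_scaleC)
    then obtain y where y: "norm y = 1" "norm (S y) = norm S"
        "Re (cinner (S y) (((- cnj (q x)) *\<^sub>C A) y)) \<ge> 0"
      using complex_inner_form.norm_attaining_direction[OF S] by blast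
    \<comment> \<open>So the form has nonpositive real part at \<open>y\<close> in the normalization in which \<open>x\<close> has value \<open>W\<close>.\<close>
    have "cinner (S y) (((- cnj (q x)) *\<^sub>C A) y) = - cnj (p y y)"
      unfolding p_def scaleC_blinfun_apply
      by (simp add: cinner_scaleC_right) (metis cinner_commute)
    then have py: "Re (p y y) \<le> 0" using y(3) by simp
    have lower: "W * (norm z)\<^sup>2 \<le> cmod (p z z)" if z: "norm (S z) = norm S * norm z" for z
    proof (cases "z = 0")
      case False
      let ?k = "1 / norm z"
      have "?k *\<^sub>R z \<in> X" using False z by (simp add: X_def blinfun.scaleR_right)
      moreover have "q (?k *\<^sub>R z) = complex_of_real (?k * ?k) * q z"
        unfolding q_def blinfun.scaleR_right
        by (simp add: scaleR_eq_scaleC cinner_scaleC_left cinner_scaleC_right)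
      ultimately have "cmod (q x) \<le> ?k * ?k * cmod (q z)"
        using xmin[of "?k *\<^sub>R z"] by (simp add: norm_mult norm_divide)
      then have "cmod (q x) * (norm z)\<^sup>2 \<le> cmod (q z)"
        using False by (simp add: field_simps power2_eq_square)
      then have "cmod (q x) * (cmod (q x) * (norm z)\<^sup>2) \<le> cmod (q x) * cmod (q z)"
        by (rule mult_left_mono) simp
      then show ?thesis by (simp add: W_def p_def q_def norm_mult power2_eq_square mult.assoc)
    qed simp
    \<comment> \<open>A phase for \<open>y\<close> makes the mixed term of the form real; its sign is still free.\<close>
    obtain e0 where e0: "cmod e0 = 1" "Im ((p y x - cnj (p x y)) * e0) = 0"
      using ex_unimodular_mult_real by metis
    define mix where "mix e = cnj e * p x y + e * p y x" for e
    have "\<exists>e. cmod e = 1 \<and> Im (mix e) = 0 \<and> Re (mix e) \<le> 2 * Re (cinner x (e *\<^sub>C y)) * W"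
    \<comment> \<open>Both sides of the inequality are odd in \<open>e\<close>.\<close>
    proof (cases "Re (mix e0) \<le> 2 * Re (cinner x (e0 *\<^sub>C y)) * W")
      case True
      then show ?thesis using e0 by (intro exI[of _ e0]) (auto simp: mix_def algebra_simps)
    next
      case False
      then show ?thesis using e0
        by (intro exI[of _ "- e0"]) (auto simp: mix_def cinner_scaleC_right algebra_simps)
    qed
    then obtain e where e: "cmod e = 1" "Im (mix e) = 0"
        "Re (mix e) \<le> 2 * Re (cinner x (e *\<^sub>C y)) * W" by blast
    let ?s = "Re (cinner x (e *\<^sub>C y))"
    obtain t where t: "t > 0"
        "(W + t * Re (mix e) + t\<^sup>2 * Re (p y y))\<^sup>2 + (t\<^sup>2 * Im (p y y))\<^sup>2 < (W * (1 + 2 * t * ?s + t\<^sup>2))\<^sup>2"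
      using ex_decreasing_step[OF W py e(3)] by blast
    define z where "z = x + t *\<^sub>R (e *\<^sub>C y)"
    have nz: "(norm z)\<^sup>2 = 1 + 2 * t * ?s + t\<^sup>2"
      unfolding z_def complex_inner_form.norm_add_scaleR_sq
      using x y e by (simp add: X_def norm_scaleC)
    have "p z z = p x x + t * mix e + t\<^sup>2 * (e * cnj e) * p y y"
      unfolding p_def z_def mix_def
      by (simp add: blinfun.add_right blinfun.scaleR_right clinear_scaleC[OF lin(1)]
          clinear_scaleC[OF lin(2)] scaleR_eq_scaleC cinner_add_left cinner_add_right
          cinner_scaleC_left cinner_scaleC_right power2_eq_square algebra_simps)
    also have "e * cnj e = 1" using e(1) by (simp add: complex_norm_square[symmetric])
    finally have "p z z = p x x + t * mix e + t\<^sup>2 * p y y" by simp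
    then have "Re (p z z) = W + t * Re (mix e) + t\<^sup>2 * Re (p y y)" "Im (p z z) = t\<^sup>2 * Im (p y y)"
      using e(2) by (simp_all add: px flip: of_real_power)
    then have "(cmod (p z z))\<^sup>2 < (W * (norm z)\<^sup>2)\<^sup>2"
      using t(2) by (simp add: cmod_power2 nz)
    then have "cmod (p z z) < W * (norm z)\<^sup>2"
      by (rule power_less_imp_less_base) (use W in simp)
    moreover have "norm (S z) = norm S * norm z"
      unfolding z_def
      by (rule complex_inner_form.norm_attaining_add)
        (use x y e in \<open>simp_all add: X_def blinfun.scaleR_right clinear_scaleC[OF lin(1)] norm_scaleC\<close>)
    ultimately show ?thesis using lower[of z] by linarith
  qed
qed

section \<open>The distance formula\<close>

lemma is_maximum_infdist_span_real:
  fixes T A :: "'a::{real_inner, complete_space} \<Rightarrow>\<^sub>L 'a"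
  assumes "compact_operator T" "compact_operator A" "T \<notin> span {A}"
  shows "is_maximum (infdist T (span {A}))
    {\<bar>T x \<bullet> y\<bar> | x y. x \<in> sphere 0 1 \<and> y \<in> sphere 0 1 \<and> orthogonal y (A x)}"
proof -
  have span: "span {A} = range (\<lambda>c. c *\<^sub>R A)" by (rule span_singleton)
  have "\<exists>c0. \<forall>c. norm (T - c0 *\<^sub>R A) \<le> norm (T - c *\<^sub>R A)"
    by (rule ex_nearest_in_range[where k = "norm A"]) (auto intro!: continuous_intros)
  then obtain c0 where c0: "\<And>c. norm (T - c0 *\<^sub>R A) \<le> norm (T - c *\<^sub>R A)" by blast
  define S where "S = T - c0 *\<^sub>R A"
  have dist: "infdist T (span {A}) = norm S"
    unfolding S_def span by (rule infdist_eq_norm_nearest) (use c0 in auto)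
  have "compact_operator (c0 *\<^sub>R A)"
    by (rule compact_operator_comp_continuous[OF assms(2), of "\<lambda>x. c0 *\<^sub>R x"])
      (auto intro!: continuous_intros simp: blinfun.scaleR_left)
  then have "compact_operator S" unfolding S_def by (intro compact_operator_diff assms)
  moreover have S0: "S \<noteq> 0" using assms(3) by (auto simp: S_def span)
  moreover have "norm S \<le> norm (S + t *\<^sub>R A)" for t
    using c0[of "c0 - t"] by (simp add: S_def algebra_simps)
  ultimately obtain x where x: "norm x = 1" "norm (S x) = norm S" "S x \<bullet> A x = 0"
    using real_inner_form.bhatia_semrl_real by metis
  let ?y = "(1 / norm S) *\<^sub>R S x"
  have "T x = S x + c0 *\<^sub>R A x" by (simp add: S_def blinfun.diff_left blinfun.scaleR_left)
  moreover have "A x \<bullet> S x = 0" using x(3) by (simp only: inner_commute)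
  ultimately have "T x \<bullet> ?y = (S x \<bullet> S x) / norm S" by (simp add: inner_add_left)
  then have "norm S = \<bar>T x \<bullet> ?y\<bar>"
    using S0 x(2) by (simp add: dot_square_norm power2_eq_square)
  moreover have "norm ?y = 1" "orthogonal ?y (A x)" using x S0 by (simp_all add: orthogonal_def)
  ultimately have "norm S \<in> {\<bar>T x \<bullet> y\<bar> | x y. x \<in> sphere 0 1 \<and> y \<in> sphere 0 1 \<and> orthogonal y (A x)}"
    using x(1) by (intro CollectI exI[of _ x] exI[of _ ?y]) (simp only: mem_sphere_0)
  moreover have "\<bar>T x \<bullet> y\<bar> \<le> norm S" if "norm x = 1" "norm y = 1" "orthogonal y (A x)" for x y
  proof -
    have "T x \<bullet> y = S x \<bullet> y"
      using that(3) inner_commute[of y "A x"]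
      by (simp add: S_def blinfun.diff_left blinfun.scaleR_left inner_diff_left orthogonal_def)
    also have "\<bar>\<dots>\<bar> \<le> norm (S x) * norm y" by (rule Cauchy_Schwarz_ineq2)
    also have "\<dots> \<le> norm S" using norm_blinfun[of S x] that by simp
    finally show ?thesis .
  qed
  ultimately show ?thesis unfolding is_maximum_def dist by auto
qed

lemma is_maximum_infdist_span_complex:
  fixes T A :: "'a::{complex_inner, complete_space} \<Rightarrow>\<^sub>L 'a"
  assumes lin: "clinear T" "clinear A"
    and "compact_operator T" "compact_operator A" "T \<notin> cspan {A}"
  shows "is_maximum (infdist T (cspan {A}))
    {cmod (cinner (T x) y) | x y. x \<in> sphere 0 1 \<and> y \<in> sphere 0 1 \<and> cinner y (A x) = 0}"
proof -
  have "\<exists>c0. \<forall>c. norm (T - c0 *\<^sub>C A) \<le> norm (T - c *\<^sub>C A)"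
    by (rule ex_nearest_in_range[where k = "norm A"])
      (auto intro!: linear_continuous_on bounded_linear_scaleC_left
        simp: norm_scaleC_blinfun simp flip: norm_eq_zero)
  then obtain c0 where c0: "\<And>c. norm (T - c0 *\<^sub>C A) \<le> norm (T - c *\<^sub>C A)" by blast
  define S where "S = T - c0 *\<^sub>C A"
  have dist: "infdist T (cspan {A}) = norm S"
    unfolding S_def cspan_singleton by (rule infdist_eq_norm_nearest) (use c0 in auto)
  have TS: "T x = S x + c0 *\<^sub>C A x" for x
    by (simp add: S_def blinfun.diff_left scaleC_blinfun_apply)
  have "compact_operator (c0 *\<^sub>C A)"
    by (rule compact_operator_comp_continuous[OF assms(4) continuous_on_scaleC_right])
      (rule scaleC_blinfun_apply)
  then have "compact_operator S" unfolding S_def by (intro compact_operator_diff assms)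
  moreover have S0: "S \<noteq> 0" using assms(5) by (auto simp: S_def cspan_singleton)
  moreover have "clinear S"
  proof -
    have "S (c *\<^sub>C x) = c *\<^sub>C S x" for c x
    proof -
      have "S (c *\<^sub>C x) + c0 *\<^sub>C A (c *\<^sub>C x) = c *\<^sub>C (S x + c0 *\<^sub>C A x)"
        unfolding TS[symmetric] by (rule clinear_scaleC[OF lin(1)])
      then show ?thesis
        by (simp add: clinear_scaleC[OF lin(2)] scaleC_add_right scaleC_scaleC mult.commute)
    qed
    then show ?thesis
      by (simp add: Vector_Spaces.linear_iff vector_space_scaleC blinfun.add_right)
  qed
  moreover have "norm S \<le> norm (S + c *\<^sub>C A)" for c
  proof -
    have "T - (c0 - c) *\<^sub>C A = S + c *\<^sub>C A"
      using scaleC_add_left[of "c0 - c" c A] by (simp add: S_def algebra_simps)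
    then show ?thesis using c0[of "c0 - c"] by (simp only: S_def)
  qed
  ultimately obtain x where x: "norm x = 1" "norm (S x) = norm S" "cinner (A x) (S x) = 0"
    using bhatia_semrl_complex lin(2) by metis
  let ?y = "(1 / complex_of_real (norm S)) *\<^sub>C S x"
  have "cinner (T x) ?y = cinner (S x) (S x) / norm S"
    using x(3) by (simp add: TS cinner_add_left cinner_scaleC_left cinner_scaleC_right)
  then have "cinner (T x) ?y = norm S"
    using S0 x(2) by (simp add: cinner_self power2_eq_square)
  then have "norm S = cmod (cinner (T x) ?y)" by simp
  moreover have "norm ?y = 1" using x S0 by (simp add: norm_scaleC norm_divide)
  moreover have "cinner ?y (A x) = 0"
    using x(3) cinner_commute[of "S x" "A x"] by (simp add: cinner_scaleC_left)
  ultimately have "norm S \<in> {cmod (cinner (T x) y) | x y. x \<in> sphere 0 1 \<and> y \<in> sphere 0 1 \<and> cinner y (A x) = 0}"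
    using x(1) by auto
  moreover have "cmod (cinner (T x) y) \<le> norm S" if "norm x = 1" "norm y = 1" "cinner y (A x) = 0" for x y
  proof -
    have "cinner (T x) y = cinner (S x) y"
      using that(3) cinner_commute[of "A x" y] by (simp add: TS cinner_add_left cinner_scaleC_left)
    also have "cmod \<dots> \<le> norm (S x) * norm y" by (rule cmod_cinner_le_norm_mult)
    also have "\<dots> \<le> norm S" using norm_blinfun[of S x] that by simp
    finally show ?thesis .
  qed
  ultimately show ?thesis unfolding is_maximum_def dist by auto
qed

theorem corollary2p10:
  fixes T A :: "'a::{real_inner, complete_space} \<Rightarrow>\<^sub>L 'a"
    and T' A' :: "'b::{complex_inner, complete_space} \<Rightarrow>\<^sub>L 'b"
  shows
    "(compact_operator T \<and> compact_operator A \<and> T \<notin> span {A} \<longrightarrow>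
        is_maximum (infdist T (span {A}))
          {\<bar>T x \<bullet> y\<bar> | x y. x \<in> sphere 0 1 \<and> y \<in> sphere 0 1 \<and> orthogonal y (A x)})
     \<and>
     (clinear T' \<and> clinear A' \<and> compact_operator T' \<and> compact_operator A' \<and> T' \<notin> cspan {A'} \<longrightarrow>
        is_maximum (infdist T' (cspan {A'}))
          {cmod (cinner (T' x) y) | x y. x \<in> sphere 0 1 \<and> y \<in> sphere 0 1 \<and> cinner y (A' x) = 0})"
  using is_maximum_infdist_span_real is_maximum_infdist_span_complex by blast

end
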